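(* For every oriented graph $D$, $$\mathrm{inv}([\overrightarrow{C_3} , \overrightarrow{C_3} , D])=\mathrm{inv}(\overrightarrow{C_3} \Rightarrow D)+1.$$
   Context: All digraphs are finite and have no loops, parallel arcs or 2-cycles (i.e. they are oriented graphs). $\overrightarrow{C_3}$ denotes the directed cycle on three vertices. For a digraph $D$ with vertex set $V(D)$ and a subset $X\subseteq V(D)$, the inversion of $X$ in $D$ is the digraph $\mathrm{Inv}(D;X)$ obtained from $D$ by reversing the direction of all arcs with both ends in $X$. For a finite family $(X_i)_{i\in I}$ of subsets of $V(D)$, $\mathrm{Inv}(D;(X_i)_{i\in I})$ is obtained by inverting the sets $X_i$ one after another (the order does not matter). The family is a decycling family if $\mathrm{Inv}(D;(X_i)_{i\in I})$ is acyclic. The inversion number $\mathrm{inv}(D)$ is the minimum cardinality $|I|$ of a decycling family of $D$. For pairwise vertex-disjoint oriented graphs $D_1,\dots,D_k$, the $k$-join $[D_1,\dots,D_k]$ is the oriented graph obtained from the disjoint union of $D_1,\dots,D_k$ by adding all arcs $xy$ with $x\in V(D_i)$, $y\in V(D_j)$, $i<j$ (if the same graph occurs several times, disjoint copies are used). The dijoin is $L\Rightarrow R=[L,R]$. *)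

theory Defs
  imports "Graph_Theory.Pair_Digraph"
begin

text \<open>Digraphs are \<open>'a pair_pre_digraph\<close> records, whose arcs are ordered pairs; parallel arcs
  are therefore excluded by the representation.  The locale \<^locale>\<open>pair_digraph\<close> contributes
  finiteness, looplessness and that arcs join vertices.\<close>

locale oriented_graph = pair_digraph G for G :: "'a pair_pre_digraph" +
  assumes no_2_cycle: "(u, v) \<in> parcs G \<Longrightarrow> (v, u) \<notin> parcs G"

definition acyclic_digraph :: "'a pair_pre_digraph \<Rightarrow> bool" where
  "acyclic_digraph G \<longleftrightarrow> acyclic (parcs G)"

definition Inv :: "'a pair_pre_digraph \<Rightarrow> 'a set \<Rightarrow> 'a pair_pre_digraph" where
  "Inv G X = \<lparr> pverts = pverts G,
     parcs = {(u, v). (u, v) \<in> parcs G \<and> \<not> (u \<in> X \<and> v \<in> X)}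
           \<union> {(v, u) | u v. (u, v) \<in> parcs G \<and> u \<in> X \<and> v \<in> X} \<rparr>"

text \<open>A finite family \<open>(X\<^sub>i)\<^sub>i\<^sub>\<in>\<^sub>I\<close> is a list, so that repeated members are allowed and
  the length is \<open>|I|\<close>.  The order of the list is immaterial (see \<open>Inv_commute\<close>).\<close>

definition Inv_family :: "'a pair_pre_digraph \<Rightarrow> 'a set list \<Rightarrow> 'a pair_pre_digraph" where
  "Inv_family G Xs = foldl Inv G Xs"

definition decycling_family :: "'a pair_pre_digraph \<Rightarrow> 'a set list \<Rightarrow> bool" where
  "decycling_family G Xs \<longleftrightarrow>
     (\<forall>X \<in> set Xs. X \<subseteq> pverts G) \<and> acyclic_digraph (Inv_family G Xs)"

text \<open>For an oriented graph the minimum is attained (see \<open>decycling_family_exists\<close>).\<close>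

definition inversion_number :: "'a pair_pre_digraph \<Rightarrow> nat" where
  "inversion_number G = (LEAST n. \<exists>Xs. decycling_family G Xs \<and> length Xs = n)"

definition directed_C3 :: "nat pair_pre_digraph" where
  "directed_C3 = \<lparr> pverts = {0, 1, 2}, parcs = {(0, 1), (1, 2), (2, 0)} \<rparr>"

text \<open>The index component \<open>i\<close> of a vertex \<open>(i, v)\<close> makes the summands disjoint, so a graph
  that occurs several times in the list contributes disjoint copies.\<close>

definition kjoin :: "'a pair_pre_digraph list \<Rightarrow> (nat \<times> 'a) pair_pre_digraph" where
  "kjoin Gs = \<lparr> pverts = {(i, v). i < length Gs \<and> v \<in> pverts (Gs ! i)},
     parcs = {((i, u), (i, v)) | i u v. i < length Gs \<and> (u, v) \<in> parcs (Gs ! i)}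
           \<union> {((i, x), (j, y)) | i j x y. i < j \<and> j < length Gs
                \<and> x \<in> pverts (Gs ! i) \<and> y \<in> pverts (Gs ! j)} \<rparr>"

definition dijoin :: "'a pair_pre_digraph \<Rightarrow> 'a pair_pre_digraph \<Rightarrow> (nat \<times> 'a) pair_pre_digraph"
  (infixr "\<Rrightarrow>" 65) where
  "L \<Rrightarrow> R = kjoin [L, R]"

text \<open>Renaming of vertices; used with the injections \<^const>\<open>Inl\<close> and \<^const>\<open>Inr\<close> only, to bring
  graphs with different vertex types into one list.\<close>

definition relabel :: "('a \<Rightarrow> 'b) \<Rightarrow> 'a pair_pre_digraph \<Rightarrow> 'b pair_pre_digraph" where
  "relabel f G = \<lparr> pverts = f ` pverts G, parcs = map_prod f f ` parcs G \<rparr>"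

lemma Inv_commute: "Inv (Inv G X) Y = Inv (Inv G Y) X"
  by (auto simp: Inv_def)

lemma oriented_graph_Inv:
  assumes "oriented_graph G" shows "oriented_graph (Inv G X)"
proof -
  interpret oriented_graph G by fact
  have sub: "parcs (Inv G X) \<subseteq> parcs G \<union> (parcs G)\<inverse>" by (auto simp: Inv_def)
  show ?thesis
  proof
    show "finite (parcs (Inv G X))"
      using finite_subset[OF sub] pair_finite_arcs by simp
    show "(v, u) \<notin> parcs (Inv G X)" if "(u, v) \<in> parcs (Inv G X)" for u v
      using that by (auto simp: Inv_def dest: no_2_cycle)
  qed (use pair_finite_verts in_arcsD1 in_arcsD2 pair_no_loops in \<open>force simp: Inv_def\<close>)+
qed

lemma oriented_graph_directed_C3: "oriented_graph directed_C3"
  by unfold_locales (auto simp: directed_C3_def)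

lemma oriented_graph_relabel:
  assumes "oriented_graph G" "inj f" shows "oriented_graph (relabel f G)"
proof -
  interpret oriented_graph G by fact
  show ?thesis
  proof
    show "finite (pverts (relabel f G))" "finite (parcs (relabel f G))"
      using pair_finite_verts pair_finite_arcs by (simp_all add: relabel_def)
    show "fst e \<in> pverts (relabel f G)" "snd e \<in> pverts (relabel f G)"
      if "e \<in> parcs (relabel f G)" for e
      using that in_arcsD1 in_arcsD2 by (auto simp: relabel_def)
    show "fst e \<noteq> snd e" if "e \<in> parcs (relabel f G)" for e
      using that pair_no_loops injD[OF \<open>inj f\<close>] by (force simp: relabel_def)
    show "(v, u) \<notin> parcs (relabel f G)" if "(u, v) \<in> parcs (relabel f G)" for u v
      using that no_2_cycle by (auto simp: relabel_def inj_eq[OF \<open>inj f\<close>])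
  qed
qed

lemma oriented_graph_kjoin:
  assumes "\<And>G. G \<in> set Gs \<Longrightarrow> oriented_graph G" shows "oriented_graph (kjoin Gs)"
proof -
  have og: "oriented_graph (Gs ! i)" if "i < length Gs" for i
    using assms that by simp
  have V: "pverts (kjoin Gs) = (SIGMA i:{..<length Gs}. pverts (Gs ! i))"
    by (auto simp: kjoin_def)
  have finV: "finite (pverts (kjoin Gs))"
    unfolding V using og
    by (auto simp: oriented_graph_def pair_digraph_def pair_fin_digraph_def
        pair_fin_digraph_axioms_def)
  have arcD: "u \<in> pverts (Gs ! i) \<and> v \<in> pverts (Gs ! i)"
    if "(u, v) \<in> parcs (Gs ! i)" "i < length Gs" for i u v
  proof -
    interpret oriented_graph "Gs ! i" by (rule og[OF that(2)])
    show ?thesis using that(1) in_arcsD1 in_arcsD2 by blast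
  qed
  have wf: "parcs (kjoin Gs) \<subseteq> pverts (kjoin Gs) \<times> pverts (kjoin Gs)"
    by (auto simp: kjoin_def dest: arcD)
  have anti: "(v, u) \<notin> parcs (kjoin Gs)" if "(u, v) \<in> parcs (kjoin Gs)" for u v
    using that og by (auto simp: kjoin_def dest: oriented_graph.no_2_cycle)
  show ?thesis
  proof
    show "finite (parcs (kjoin Gs))"
      using wf finV by (auto intro: finite_subset)
    show "fst e \<noteq> snd e" if "e \<in> parcs (kjoin Gs)" for e
      using anti that by (cases e) auto
  qed (use finV wf anti in auto)
qed

lemma decycling_family_exists:
  fixes G :: "'a pair_pre_digraph"
  assumes "oriented_graph G" shows "\<exists>Xs. decycling_family G Xs"
proof -
  from assms have "finite (pverts G)"
    by (simp add: oriented_graph_def pair_digraph_def pair_fin_digraph_def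
        pair_fin_digraph_axioms_def)
  from finite_imp_inj_to_nat_seg[OF this]
  obtain f :: "'a \<Rightarrow> nat" where inj: "inj_on f (pverts G)" by auto
  show ?thesis using assms inj
  proof (induction "card {(u, v) \<in> parcs G. f v < f u}" arbitrary: G rule: less_induct)
    case less
    interpret oriented_graph G by fact
    let ?B = "{(u, v) \<in> parcs G. f v < f u}"
    show ?case
    proof (cases "?B = {}")
      case True
      have "f u < f v" if "(u, v) \<in> parcs G" for u v
      proof -
        have "f u \<noteq> f v"
          using less.prems(2) in_arcsD1[OF that] in_arcsD2[OF that] pair_no_loops[OF that]
          by (auto simp: inj_on_def)
        moreover have "\<not> f v < f u" using True that by blast
        ultimately show ?thesis by simp
      qed
      then have "parcs G \<subseteq> measure f" by auto
      then have "acyclic (parcs G)"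
        by (meson acyclic_subset wf_acyclic wf_measure)
      then have "decycling_family G []"
        by (simp add: decycling_family_def Inv_family_def acyclic_digraph_def)
      then show ?thesis ..
    next
      case False
      then obtain a b where ab: "(a, b) \<in> parcs G" "f b < f a" by auto
      let ?H = "Inv G {a, b}"
      have "{(u, v) \<in> parcs ?H. f v < f u} \<subseteq> ?B - {(a, b)}"
        using ab no_2_cycle pair_no_loops by (auto simp: Inv_def)
      moreover have "finite ?B"
        using pair_finite_arcs by (rule rev_finite_subset) auto
      ultimately have "card {(u, v) \<in> parcs ?H. f v < f u} < card ?B"
        using ab by (intro psubset_card_mono) blast+
      moreover have "pverts ?H = pverts G" by (simp add: Inv_def)
      ultimately obtain Xs where "decycling_family ?H Xs"
        using less.hyps[of ?H] oriented_graph_Inv less.prems by metis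
      then have "decycling_family G ({a, b} # Xs)"
        using ab in_arcsD1 in_arcsD2
        by (auto simp: decycling_family_def Inv_family_def Inv_def)
      then show ?thesis ..
    qed
  qed
qed

end

theory Submission
  imports Defs "HOL-Library.Z2"
begin

text \<open>Give every vertex \<open>v\<close> the vector \<open>x v\<close> over the two-element field whose \<open>i\<close>-th entry
  tells whether \<open>v\<close> lies in the \<open>i\<close>-th set of a family of \<open>k\<close> sets.  The arc \<open>uv\<close> is reversed by the
  family iff \<open>x u\<close> and \<open>x v\<close> have dot product 1.  So \<open>inv(G) \<le> k\<close> means that there are vectors of
  length \<open>k\<close> and a linear order \<open>f\<close> of the vertices such that, for every arc \<open>uv\<close>, the dot product
  is 1 iff \<open>v\<close> precedes \<open>u\<close> (\<open>decycling_family_iff_decyclable\<close>).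

  The upper bound holds because inversion numbers are subadditive under joins
  (\<open>decyclable_kjoin_Cons\<close>).

  For the lower bound let \<open>G\<close> be the join of a 3-cycle and \<open>R\<close>, with vectors of length \<open>k\<close> and an order.
  Let \<open>p\<close>, \<open>q\<close>, \<open>r\<close> be the vectors of the 3-cycle, listed along the order.  As the 3-cycle dominates
  \<open>R\<close>, the product of \<open>p\<close> with \<open>x w\<close>, for \<open>w\<close> in \<open>R\<close>, only tells whether \<open>w\<close> comes before the first
  vertex of the cycle, and similarly for \<open>q\<close> and \<open>r\<close>; hence \<open>p + q\<close> detects an interval of the order.
  If \<open>c\<close> is one of these vectors, changing the products within \<open>R\<close> from \<open>x \<bullet> y\<close> to
  \<open>x \<bullet> y + (x \<bullet> c)(y \<bullet> c)\<close> reverses all arcs inside an interval of the order, which can be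
  compensated by reversing the interval in the order.  On the other hand, if \<open>c \<bullet> c = 1\<close>, the new
  products are those of the orthogonal projections along \<open>c\<close>, a space of dimension \<open>k - 1\<close>.  That
  space is isometric to the standard one of dimension \<open>k - 1\<close> unless \<open>c\<close> is the all-ones vector
  (\<open>project_odd_vector\<close>).  If \<open>c\<close> and \<open>d\<close> are among \<open>p\<close>, \<open>q\<close>, \<open>r\<close> with \<open>c \<bullet> c = d \<bullet> d = 0\<close> and
  \<open>c \<bullet> d = 1\<close>, reversing two intervals saves a dimension too (\<open>project_hyperbolic_pair\<close>).
  Since \<open>p \<bullet> q = q \<bullet> r \<noteq> p \<bullet> r\<close>, one of these reductions applies, except when \<open>p\<close> and \<open>r\<close> are the
  all-ones vector of odd length and \<open>q = 0\<close> (\<open>remove_three_vectors\<close>).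

  The reductions yield a family of \<open>k - 1\<close> sets for \<open>R\<close>, which is what is wanted when \<open>R\<close> is the
  join of the second 3-cycle and \<open>D\<close>.  In the exceptional case \<open>q = 0\<close> says that no vertex of \<open>R\<close>
  comes before the middle vertex of the cycle, so none comes before the first one, and every vector
  of \<open>R\<close> is orthogonal to \<open>p\<close>, that is, has even weight.  Then the second 3-cycle contains a
  hyperbolic pair, which can be projected away together with the all-ones vector; this leaves a family of \<open>k - 2\<close> sets for \<open>D\<close> alone (\<open>remove_three_even_vectors\<close>).
  One more set decycles the 3-cycle in front of \<open>D\<close>.\<close>

section \<open>Vectors over the two-element field\<close>

text \<open>Arithmetic in \<^typ>\<open>bit\<close> is kept in ring form, so that equations of the field can be decided
  by sorting monomials and cancelling equal ones.\<close>

declare add_bit_eq_xor [simp del] mult_bit_eq_and [simp del]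

lemma bit_add_self: "a + a = 0" for a :: bit
  by (cases a) simp_all

lemma bit_add_left_self: "a + (a + b) = b" for a b :: bit
  by (cases a) (simp_all flip: add.assoc)

lemma bit_mult_self: "a * a = a" "a * (a * b) = a * b" for a b :: bit
  by (cases a; simp)+

lemmas bit_ring = algebra_simps bit_add_self bit_add_left_self bit_mult_self

definition dot :: "'i set \<Rightarrow> ('i \<Rightarrow> bit) \<Rightarrow> ('i \<Rightarrow> bit) \<Rightarrow> bit" where
  "dot I x y = (\<Sum>i\<in>I. x i * y i)"

lemma dot_commute: "dot I x y = dot I y x"
  by (simp add: dot_def mult.commute)

lemma dot_add_left: "dot I (\<lambda>i. x i + y i) z = dot I x z + dot I y z"
  by (simp add: dot_def distrib_right sum.distrib)

lemma dot_add_right: "dot I z (\<lambda>i. x i + y i) = dot I z x + dot I z y"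
  by (simp add: dot_def distrib_left sum.distrib)

lemma dot_scale_left: "dot I (\<lambda>i. a * x i) z = a * dot I x z"
  by (simp add: dot_def sum_distrib_left mult.assoc)

lemma dot_scale_right: "dot I z (\<lambda>i. a * x i) = a * dot I z x"
  by (simp add: dot_def sum_distrib_left mult.left_commute)

lemma dot_zero_left: "dot I (\<lambda>i. 0) z = 0"
  by (simp add: dot_def)

lemma dot_unit_right:
  assumes "finite I" "j \<in> I" shows "dot I z (\<lambda>i. of_bool (i = j)) = z j"
proof -
  have "dot I z (\<lambda>i. of_bool (i = j)) = (\<Sum>i\<in>I. if i = j then z i else 0)"
    unfolding dot_def by (rule sum.cong) auto
  then show ?thesis using assms by simp
qed

lemma dot_ones_right: "dot I x (\<lambda>i. 1) = dot I x x"
  by (simp add: dot_def bit_mult_self)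

lemma dot_ones_ones: "finite I \<Longrightarrow> dot I (\<lambda>i. 1) (\<lambda>i. 1) = of_bool (odd (card I))"
  by (induction rule: finite_induct) (auto simp: dot_def bit_add_self)

lemma dot_cong: "(\<And>i. i \<in> I \<Longrightarrow> x i = x' i) \<Longrightarrow> (\<And>i. i \<in> I \<Longrightarrow> y i = y' i) \<Longrightarrow> dot I x y = dot I x' y'"
  by (simp add: dot_def)

lemma dot_remove:
  assumes "finite I" "j \<in> I" shows "dot (I - {j}) x y = dot I x y + x j * y j"
  using sum.remove[OF assms, of "\<lambda>i. x i * y i"] by (simp add: dot_def bit_ring)

lemmas dot_bilinear = dot_add_left dot_add_right dot_scale_left dot_scale_right

text \<open>The vector \<open>c = w + e\<^sub>j\<close> has \<open>c \<bullet> c = 0\<close>, so the transvection \<open>x \<mapsto> x + (x \<bullet> c) c\<close> is an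
  isometry.  It maps \<open>w\<close> to the unit vector \<open>e\<^sub>j\<close>, so the \<open>j\<close>-th entry of the image of \<open>x\<close> is \<open>x \<bullet> w\<close>,
  and deleting this entry removes the term \<open>(x \<bullet> w)(y \<bullet> w)\<close> from the product.\<close>

lemma project_odd_vector:
  assumes "finite I" "j \<in> I" "w j = 0" "dot I w w = 1"
  obtains \<phi> :: "('i \<Rightarrow> bit) \<Rightarrow> 'i \<Rightarrow> bit" where
    "\<And>x y. dot (I - {j}) (\<phi> x) (\<phi> y) = dot I x y + dot I x w * dot I y w"
proof -
  define c where "c = (\<lambda>i. w i + of_bool (i = j))"
  define \<phi> where "\<phi> = (\<lambda>x i. x i + (dot I x w + x j) * c i)"
  have xc: "dot I x c = dot I x w + x j" for x
    unfolding c_def by (simp add: dot_bilinear dot_unit_right assms)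
  have cx: "dot I c x = dot I x w + x j" for x
    using xc dot_commute by metis
  have cj: "c j = 1" by (simp add: c_def assms)
  have "dot I c w = 1" unfolding cx by (simp add: assms)
  then have cc: "dot I c c = 0" unfolding xc cj by simp
  show thesis
  proof (rule that[of \<phi>])
    fix x y :: "'i \<Rightarrow> bit"
    show "dot (I - {j}) (\<phi> x) (\<phi> y) = dot I x y + dot I x w * dot I y w"
      unfolding \<phi>_def dot_remove[OF assms(1,2)] dot_bilinear cc xc cx cj
      by (simp add: assms(3,4) bit_ring)
  qed
qed

text \<open>Conceptually, \<open>(x \<bullet> u)(y \<bullet> v) + (x \<bullet> v)(y \<bullet> u)\<close> accounts for the projection onto the orthogonal
  complement of \<open>u\<close> and \<open>v\<close>, of dimension two less.  But on that complement the form may be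
  alternating, and then it embeds only into a standard space of one dimension more.  The form below
  differs by the term \<open>(x \<bullet> v)(y \<bullet> v)\<close>.  It has one dimension less than the full form and is not
  alternating; its difference from \<open>x \<bullet> y\<close> is a sum of two products \<open>\<lambda>(x) \<lambda>(y)\<close> with \<open>\<lambda>\<close> linear,
  each of which is the reversal of an interval.\<close>

lemma project_hyperbolic_pair:
  assumes I: "finite I" and uv: "dot I u u = 0" "dot I v v = 0" "dot I u v = 1"
  obtains j and \<phi> :: "('i \<Rightarrow> bit) \<Rightarrow> 'i \<Rightarrow> bit" where "j \<in> I"
    "\<And>x y. dot (I - {j}) (\<phi> x) (\<phi> y) = dot I x y + dot I x u * dot I y u
        + (dot I x u + dot I x v) * (dot I y u + dot I y v)"
proof -
  have "\<exists>j\<in>I. u j = 0 \<and> v j = 1"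
  proof (rule ccontr)
    assume "\<not> ?thesis"
    then have "u i * v i = v i * v i" if "i \<in> I" for i
      using that by (cases "u i"; cases "v i") auto
    then have "dot I u v = dot I v v"
      unfolding dot_def by (rule sum.cong[OF refl])
    with uv show False by simp
  qed
  then obtain j where j: "j \<in> I" "u j = 0" "v j = 1" by blast
  \<comment> \<open>The choice of \<open>j\<close> makes the \<open>j\<close>-th entry of \<open>\<phi> x\<close> equal to \<open>x \<bullet> v\<close>; with it, \<open>\<phi>\<close> turns the product
    into \<open>x \<bullet> y + (x \<bullet> u)(y \<bullet> v) + (x \<bullet> v)(y \<bullet> u)\<close>.\<close>
  define \<phi> where "\<phi> = (\<lambda>x i. x i + ((dot I x u + x j) * u i + (dot I x v + x j) * v i))"
  have vu: "dot I v u = 1" using uv dot_commute by metis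
  show thesis
  proof (rule that[of j \<phi>, OF j(1)])
    fix x y :: "'i \<Rightarrow> bit"
    show "dot (I - {j}) (\<phi> x) (\<phi> y) = dot I x y + dot I x u * dot I y u
        + (dot I x u + dot I x v) * (dot I y u + dot I y v)"
      unfolding \<phi>_def dot_remove[OF I j(1)] dot_bilinear
      by (simp add: uv vu j dot_commute[of I u x] dot_commute[of I v x]
          dot_commute[of I u y] dot_commute[of I v y] bit_ring)
  qed
qed

text \<open>In odd dimension the all-ones vector \<open>\<one>\<close> has odd weight, hence so has \<open>u + \<one>\<close>, whose
  product with an even vector \<open>x\<close> is \<open>x \<bullet> u\<close>.  Projecting along \<open>u + \<one>\<close> therefore
  adds \<open>(x \<bullet> u)(y \<bullet> u)\<close> and makes the image of \<open>v\<close> odd.  That image is not the all-ones vector,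
  because the dimension has become even, so a second projection is possible.\<close>

lemma project_hyperbolic_pair_and_ones:
  assumes I: "finite I" "odd (card I)"
    and uv: "dot I u u = 0" "dot I v v = 0" "dot I u v = 1"
  obtains J and \<phi> :: "('i \<Rightarrow> bit) \<Rightarrow> 'i \<Rightarrow> bit" where "finite J" "card I = card J + 2"
    "\<And>x y. dot I x (\<lambda>i. 1) = 0 \<Longrightarrow> dot I y (\<lambda>i. 1) = 0 \<Longrightarrow>
       dot J (\<phi> x) (\<phi> y) = dot I x y + dot I x u * dot I y u
        + (dot I x u + dot I x v) * (dot I y u + dot I y v)"
proof -
  define w where "w = (\<lambda>i. u i + 1)"
  have vu: "dot I v u = 1" using uv dot_commute by metis
  have one: "dot I x (\<lambda>i. 1) = dot I x x" "dot I (\<lambda>i. 1) x = dot I x x" for x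
    using dot_ones_right dot_commute by metis+
  have "\<exists>j\<in>I. u j = 1"
  proof (rule ccontr)
    assume "\<not> ?thesis"
    then have "dot I u v = dot I (\<lambda>i. 0) v" by (intro dot_cong) auto
    with uv show False by (simp add: dot_zero_left)
  qed
  then obtain j where j: "j \<in> I" "w j = 0" by (auto simp: w_def)
  have xw: "dot I x w = dot I x u + dot I x x" for x
    unfolding w_def dot_bilinear one ..
  have "dot I w w = 1"
    unfolding w_def dot_bilinear one[of u] using I uv by (simp add: dot_ones_ones)
  from project_odd_vector[where w = w, OF I(1) j this]
  obtain \<phi> :: "('i \<Rightarrow> bit) \<Rightarrow> 'i \<Rightarrow> bit" where \<phi>:
    "\<And>x y. dot (I - {j}) (\<phi> x) (\<phi> y) = dot I x y + dot I x w * dot I y w" by blast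
  let ?v = "\<phi> v"
  have v1: "dot (I - {j}) ?v ?v = 1" unfolding \<phi> xw by (simp add: uv vu)
  have "\<exists>l\<in>I - {j}. ?v l = 0"
  proof (rule ccontr)
    assume "\<not> ?thesis"
    then have "dot (I - {j}) ?v ?v = dot (I - {j}) (\<lambda>i. 1) (\<lambda>i. 1)" by (intro dot_cong) auto
    also have "\<dots> = 0" using I j by (simp add: dot_ones_ones)
    finally show False using v1 by simp
  qed
  then obtain l where l: "l \<in> I - {j}" "?v l = 0" by blast
  from project_odd_vector[where w = ?v, OF _ l v1] I(1)
  obtain \<psi> :: "('i \<Rightarrow> bit) \<Rightarrow> 'i \<Rightarrow> bit" where \<psi>:
    "\<And>x y. dot (I - {j} - {l}) (\<psi> x) (\<psi> y)
      = dot (I - {j}) x y + dot (I - {j}) x ?v * dot (I - {j}) y ?v" by blast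
  show thesis
  proof (rule that[of "I - {j} - {l}" "\<lambda>x. \<psi> (\<phi> x)"])
    show "finite (I - {j} - {l})" using I by simp
    have "card (I - {j}) = Suc (card (I - {j} - {l}))" "card I = Suc (card (I - {j}))"
      using I j l by (metis card.remove finite_Diff)+
    then show "card I = card (I - {j} - {l}) + 2" by simp
    fix x y :: "'i \<Rightarrow> bit"
    assume "dot I x (\<lambda>i. 1) = 0" "dot I y (\<lambda>i. 1) = 0"
    then have "dot I x x = 0" "dot I y y = 0" by (simp_all add: one)
    then show "dot (I - {j} - {l}) (\<psi> (\<phi> x)) (\<psi> (\<phi> y))
        = dot I x y + dot I x u * dot I y u
        + (dot I x u + dot I x v) * (dot I y u + dot I y v)"
      unfolding \<psi> \<phi> xw by (simp add: uv vu bit_ring)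
  qed
qed

section \<open>Decycling families as vector labellings\<close>

text \<open>The value \<open>\<beta> u v = 1\<close> means that the arc \<open>uv\<close> is reversed; \<open>f\<close> is then a topological
  numbering of the resulting digraph.\<close>

definition orders :: "('v \<Rightarrow> 'v \<Rightarrow> bit) \<Rightarrow> ('v \<Rightarrow> nat) \<Rightarrow> ('v \<times> 'v) set \<Rightarrow> bool" where
  "orders \<beta> f E \<longleftrightarrow> (\<forall>(u, v) \<in> E. if \<beta> u v = 0 then f u < f v else f v < f u)"

definition decyclable :: "('v \<times> 'v) set \<Rightarrow> nat \<Rightarrow> bool" where
  "decyclable E k \<longleftrightarrow> (\<exists>x f. orders (\<lambda>u v. dot {..<k} (x u) (x v)) f E)"

text \<open>Index sets other than initial segments arise from deleting a coordinate and from disjoint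
  unions.\<close>

lemma decyclableI:
  fixes x :: "'v \<Rightarrow> 'i \<Rightarrow> bit"
  assumes "finite I" "orders (\<lambda>u v. dot I (x u) (x v)) f E"
  shows "decyclable E (card I)"
proof -
  obtain h where h: "bij_betw h {..<card I} I"
    using ex_bij_betw_nat_finite[OF assms(1)] by (auto simp: atLeast0LessThan)
  have "dot {..<card I} (\<lambda>i. y (h i)) (\<lambda>i. z (h i)) = dot I y z" for y z :: "'i \<Rightarrow> bit"
    unfolding dot_def by (rule sum.reindex_bij_betw[OF h])
  with assms(2) have "orders (\<lambda>u v. dot {..<card I} ((\<lambda>v i. x v (h i)) u) ((\<lambda>v i. x v (h i)) v)) f E"
    by simp
  then show ?thesis unfolding decyclable_def by (intro exI)
qed

lemma parcs_Inv_family: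
  "(u, v) \<in> parcs (Inv_family G Xs) \<longleftrightarrow>
     (if (\<Sum>X\<leftarrow>Xs. of_bool (u \<in> X \<and> v \<in> X) :: bit) = 0 then (u, v) \<in> parcs G else (v, u) \<in> parcs G)"
proof (induction Xs arbitrary: G)
  case Nil
  then show ?case by (simp add: Inv_family_def)
next
  case (Cons X Xs)
  have "Inv_family G (X # Xs) = Inv_family (Inv G X) Xs" by (simp add: Inv_family_def)
  then show ?case
    using Cons.IH[of "Inv G X"] by (auto simp: Inv_def)
qed

text \<open>The number of proper ancestors of a vertex strictly increases along arcs.\<close>

lemma finite_acyclic_ranking:
  assumes "finite r" "acyclic r"
  obtains f :: "'v \<Rightarrow> nat" where "\<And>u v. (u, v) \<in> r \<Longrightarrow> f u < f v"
proof
  fix u v assume uv: "(u, v) \<in> r"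
  have "finite (r\<^sup>+)" using assms(1) by simp
  then have fin: "finite {w. (w, v) \<in> r\<^sup>+}"
    by (rule finite_surj[of _ _ fst]) force
  have "{w. (w, u) \<in> r\<^sup>+} \<subseteq> {w. (w, v) \<in> r\<^sup>+}" using uv by auto
  moreover have "u \<in> {w. (w, v) \<in> r\<^sup>+}" "u \<notin> {w. (w, u) \<in> r\<^sup>+}"
    using uv assms(2) by (auto simp: acyclic_def)
  ultimately show "card {w. (w, u) \<in> r\<^sup>+} < card {w. (w, v) \<in> r\<^sup>+}"
    using fin by (intro psubset_card_mono) blast+
qed

lemma decycling_family_iff_decyclable:
  assumes "oriented_graph G"
  shows "(\<exists>Xs. decycling_family G Xs \<and> length Xs = k) \<longleftrightarrow> decyclable (parcs G) k"
proof -
  interpret oriented_graph G by fact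
  show ?thesis
  proof
    assume "\<exists>Xs. decycling_family G Xs \<and> length Xs = k"
    then obtain Xs where Xs: "acyclic (parcs (Inv_family G Xs))" "length Xs = k"
      by (auto simp: decycling_family_def acyclic_digraph_def)
    have "parcs (Inv_family G Xs) \<subseteq> parcs G \<union> (parcs G)\<inverse>"
      by (auto simp: parcs_Inv_family split: if_splits)
    then have "finite (parcs (Inv_family G Xs))"
      using finite_subset pair_finite_arcs by (metis finite_Un finite_converse)
    from finite_acyclic_ranking[OF this Xs(1)] obtain f :: "'a \<Rightarrow> nat" where
      f: "\<And>u v. (u, v) \<in> parcs (Inv_family G Xs) \<Longrightarrow> f u < f v" by blast
    define x :: "'a \<Rightarrow> nat \<Rightarrow> bit" where "x = (\<lambda>v i. of_bool (v \<in> Xs ! i))"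
    have dot_x: "dot {..<k} (x u) (x v) = (\<Sum>X\<leftarrow>Xs. of_bool (u \<in> X \<and> v \<in> X))" for u v
      unfolding dot_def x_def sum_list_sum_nth Xs(2)[symmetric]
      by (simp add: atLeast0LessThan of_bool_conj)
    have "orders (\<lambda>u v. dot {..<k} (x u) (x v)) f (parcs G)"
      unfolding orders_def dot_x using f
      by (auto simp: parcs_Inv_family conj_commute)
    then show "decyclable (parcs G) k" unfolding decyclable_def by blast
  next
    assume "decyclable (parcs G) k"
    then obtain x :: "'a \<Rightarrow> nat \<Rightarrow> bit" and f
      where f: "orders (\<lambda>u v. dot {..<k} (x u) (x v)) f (parcs G)"
      unfolding decyclable_def by blast
    define Xs where "Xs = map (\<lambda>i. {v \<in> pverts G. x v i = 1}) [0..<k]"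
    have dot_x: "(\<Sum>X\<leftarrow>Xs. of_bool (u \<in> X \<and> v \<in> X)) = dot {..<k} (x u) (x v)"
      if "u \<in> pverts G" "v \<in> pverts G" for u v
      unfolding dot_def Xs_def sum_list_sum_nth
      using that by (auto simp: atLeast0LessThan of_bool_def intro!: sum.cong)
    have "f u < f v" if "(u, v) \<in> parcs (Inv_family G Xs)" for u v
    proof -
      have "u \<in> pverts G" "v \<in> pverts G"
        using that in_arcsD1 in_arcsD2 by (auto simp: parcs_Inv_family split: if_splits)
      note d = dot_x[OF this]
      show ?thesis
        using that f unfolding parcs_Inv_family d orders_def
        by (auto split: if_splits simp: dot_commute[of _ "x v"])
    qed
    then have "parcs (Inv_family G Xs) \<subseteq> measure f" by auto
    then have "acyclic (parcs (Inv_family G Xs))"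
      by (meson acyclic_subset wf_acyclic wf_measure)
    then have "decycling_family G Xs \<and> length Xs = k"
      by (auto simp: decycling_family_def acyclic_digraph_def Xs_def)
    then show "\<exists>Xs. decycling_family G Xs \<and> length Xs = k" ..
  qed
qed

lemma inversion_number_eq_Least:
  assumes "oriented_graph G"
  shows "inversion_number G = (LEAST k. decyclable (parcs G) k)"
  by (simp add: inversion_number_def decycling_family_iff_decyclable[OF assms])

lemma decyclable_inversion_number:
  assumes "oriented_graph G"
  shows "decyclable (parcs G) (inversion_number G)"
  unfolding inversion_number_eq_Least[OF assms]
  using decycling_family_exists[OF assms] decycling_family_iff_decyclable[OF assms]
  by (metis LeastI)

lemma inversion_number_le:
  assumes "oriented_graph G" "decyclable (parcs G) k"
  shows "inversion_number G \<le> k"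
  unfolding inversion_number_eq_Least[OF assms(1)] using assms(2) by (rule Least_le)

section \<open>Reversing intervals of an order\<close>

text \<open>A vertex outside an interval lies on the same side of all its members, so reflecting the interval
  reverses exactly the arcs within it.\<close>

lemma orders_reverse_interval:
  assumes "orders \<beta> f E"
  shows "orders (\<lambda>u v. \<beta> u v + of_bool (s \<le> f u \<and> f u < t) * of_bool (s \<le> f v \<and> f v < t))
    (\<lambda>u. if s \<le> f u \<and> f u < t then s + t - 1 - f u else f u) E"
  unfolding orders_def
proof (intro ballI, clarify)
  fix u v assume "(u, v) \<in> E"
  then have "if \<beta> u v = 0 then f u < f v else f v < f u" using assms by (auto simp: orders_def)
  then show "if \<beta> u v + of_bool (s \<le> f u \<and> f u < t) * of_bool (s \<le> f v \<and> f v < t) = 0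
    then (if s \<le> f u \<and> f u < t then s + t - 1 - f u else f u)
      < (if s \<le> f v \<and> f v < t then s + t - 1 - f v else f v)
    else (if s \<le> f v \<and> f v < t then s + t - 1 - f v else f v)
      < (if s \<le> f u \<and> f u < t then s + t - 1 - f u else f u)"
    by (cases "\<beta> u v") auto
qed

lemma orders_reverse_initial:
  assumes "orders \<beta> f E"
  obtains g where "orders (\<lambda>u v. \<beta> u v + of_bool (f u < t) * of_bool (f v < t)) g E"
  using orders_reverse_interval[OF assms, of 0 t] by auto

lemma orders_reverse_between:
  assumes "orders \<beta> f E" "s \<le> t"
  obtains g where "orders (\<lambda>u v. \<beta> u v + (of_bool (f u < s) + of_bool (f u < t))
      * (of_bool (f v < s) + of_bool (f v < t))) g E"
proof -
  have "(of_bool (f u < s) + of_bool (f u < t) :: bit) = of_bool (s \<le> f u \<and> f u < t)" for u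
    using assms(2) by auto
  with orders_reverse_interval[OF assms(1), of s t] that show thesis by auto
qed

text \<open>Reversing the segment below \<open>s\<close> permutes that segment and fixes the rest, hence does not change
  which vertices lie below \<open>s\<close> and which below \<open>t\<close>.\<close>

lemma orders_reverse_initial_and_between:
  assumes "orders \<beta> f E" "s \<le> t"
  obtains g where "orders (\<lambda>u v. \<beta> u v + of_bool (f u < s) * of_bool (f v < s)
      + (of_bool (f u < s) + of_bool (f u < t)) * (of_bool (f v < s) + of_bool (f v < t))) g E"
proof -
  define g where "g = (\<lambda>u. if 0 \<le> f u \<and> f u < s then 0 + s - 1 - f u else f u)"
  have g: "orders (\<lambda>u v. \<beta> u v + of_bool (f u < s) * of_bool (f v < s)) g E"
    using orders_reverse_interval[OF assms(1), of 0 s] by (simp add: g_def)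
  have "g u < s \<longleftrightarrow> f u < s" "g u < t \<longleftrightarrow> f u < t" for u
    using assms(2) by (auto simp: g_def)
  with orders_reverse_between[OF g assms(2)] that show thesis by auto
qed

lemma orders_cong:
  assumes "orders \<beta> f E" "\<And>u v. (u, v) \<in> E \<Longrightarrow> \<beta> u v = \<beta>' u v"
  shows "orders \<beta>' f E"
  using assms by (auto simp: orders_def)

section \<open>Removing a dominating 3-cycle\<close>

text \<open>Here \<open>E\<close> is what remains after the 3-cycle with vectors \<open>p\<close>, \<open>q\<close>, \<open>r\<close> at positions
  \<open>s1 < s2 < s3\<close> has been removed.  Suppose that no coordinate can be saved.  By the projection lemmas each of
  \<open>p\<close>, \<open>q\<close>, \<open>r\<close>, \<open>p + q\<close> with odd weight is the all-ones vector, and no two of \<open>p\<close>, \<open>q\<close>, \<open>r\<close> form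
  a hyperbolic pair.  The product of the all-ones vector with \<open>z\<close> is \<open>z \<bullet> z\<close>, so the hypotheses on the mutual
  products leave only \<open>p\<close> and \<open>r\<close> odd and \<open>q\<close> even.  Then \<open>p + q\<close> is odd too, so \<open>q = 0\<close>; no
  vertex comes before \<open>s2\<close>, hence none before \<open>s1\<close>, and all remaining vectors are orthogonal to \<open>p\<close>.\<close>

lemma remove_three_vectors:
  fixes x :: "'v \<Rightarrow> 'i \<Rightarrow> bit"
  assumes I: "finite I" and ord: "orders (\<lambda>u v. dot I (x u) (x v)) f E" and E: "E \<subseteq> W \<times> W"
    and st: "s1 < s2" "s2 < s3"
    and p: "\<And>w. w \<in> W \<Longrightarrow> dot I (x w) p = of_bool (f w < s1)"
    and q: "\<And>w. w \<in> W \<Longrightarrow> dot I (x w) q = of_bool (f w < s2)"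
    and r: "\<And>w. w \<in> W \<Longrightarrow> dot I (x w) r = of_bool (f w < s3)"
    and pqr: "dot I q r = dot I p q" "dot I p r = dot I p q + 1"
  shows "(\<exists>k. card I = Suc k \<and> decyclable E k)
    \<or> odd (card I) \<and> (\<forall>w\<in>W. dot I (x w) (\<lambda>i. 1) = 0)"
proof (rule ccontr)
  assume neg: "\<not> ?thesis"
  have no_drop: False if "j \<in> I" "orders (\<lambda>u v. dot (I - {j}) (y u) (y v)) g E"
    for j g and y :: "'v \<Rightarrow> 'i \<Rightarrow> bit"
    using decyclableI[OF _ that(2)] neg I card.remove[OF I that(1)] by auto
  have WE: "u \<in> W" "v \<in> W" if "(u, v) \<in> E" for u v using E that by auto
  have odd_ones: "c i = 1"
    if c: "dot I c c = 1" "\<And>w. w \<in> W \<Longrightarrow> dot I (x w) c = of_bool (f w < t)"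
      and i: "i \<in> I" for c t i
  proof (rule ccontr)
    assume "c i \<noteq> 1"
    then have "c i = 0" by simp
    from project_odd_vector[where w = c, OF I i this c(1)]
    obtain \<phi> :: "('i \<Rightarrow> bit) \<Rightarrow> 'i \<Rightarrow> bit" where
      \<phi>: "\<And>x y. dot (I - {i}) (\<phi> x) (\<phi> y) = dot I x y + dot I x c * dot I y c"
      by blast
    obtain g where "orders (\<lambda>u v. dot I (x u) (x v) + of_bool (f u < t) * of_bool (f v < t)) g E"
      using orders_reverse_initial[OF ord] .
    then have "orders (\<lambda>u v. dot (I - {i}) (\<phi> (x u)) (\<phi> (x v))) g E"
      by (rule orders_cong) (simp add: \<phi> c WE)
    from no_drop[OF i this] show False .
  qed
  have odd_sum_ones: "c i + d i = 1"
    if c: "dot I c c + dot I d d = 1" "\<And>w. w \<in> W \<Longrightarrow> dot I (x w) c = of_bool (f w < s)"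
      and d: "\<And>w. w \<in> W \<Longrightarrow> dot I (x w) d = of_bool (f w < t)" and st: "s < t"
      and i: "i \<in> I" for c d s t i
  proof (rule ccontr)
    let ?c = "\<lambda>i. c i + d i"
    assume "c i + d i \<noteq> 1"
    then have c0: "?c i = 0" by simp
    have "dot I ?c ?c = 1"
      using c(1) by (simp add: dot_bilinear dot_commute[of I d c] bit_ring)
    from project_odd_vector[where w = ?c, OF I i c0 this]
    obtain \<phi> :: "('i \<Rightarrow> bit) \<Rightarrow> 'i \<Rightarrow> bit" where
      \<phi>: "\<And>x y. dot (I - {i}) (\<phi> x) (\<phi> y) = dot I x y + dot I x ?c * dot I y ?c"
      by blast
    obtain g where "orders (\<lambda>u v. dot I (x u) (x v) + (of_bool (f u < s) + of_bool (f u < t))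
      * (of_bool (f v < s) + of_bool (f v < t))) g E"
      using orders_reverse_between[OF ord] st less_imp_le by blast
    then have "orders (\<lambda>u v. dot (I - {i}) (\<phi> (x u)) (\<phi> (x v))) g E"
      by (rule orders_cong) (simp add: \<phi> c d WE dot_add_right)
    from no_drop[OF i this] show False .
  qed
  have not_hyperbolic: False
    if cd: "dot I c c = 0" "dot I d d = 0" "dot I c d = 1"
      and c: "\<And>w. w \<in> W \<Longrightarrow> dot I (x w) c = of_bool (f w < s)"
      and d: "\<And>w. w \<in> W \<Longrightarrow> dot I (x w) d = of_bool (f w < t)" and st: "s < t"
    for c d s t
  proof -
    obtain j and \<phi> :: "('i \<Rightarrow> bit) \<Rightarrow> 'i \<Rightarrow> bit" where j: "j \<in> I"
      and \<phi>: "\<And>x y. dot (I - {j}) (\<phi> x) (\<phi> y) = dot I x y + dot I x c * dot I y c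
        + (dot I x c + dot I x d) * (dot I y c + dot I y d)"
      using project_hyperbolic_pair[OF I cd] by metis
    obtain g where "orders (\<lambda>u v. dot I (x u) (x v) + of_bool (f u < s) * of_bool (f v < s)
      + (of_bool (f u < s) + of_bool (f u < t)) * (of_bool (f v < s) + of_bool (f v < t))) g E"
      using orders_reverse_initial_and_between[OF ord] st less_imp_le by blast
    then have "orders (\<lambda>u v. dot (I - {j}) (\<phi> (x u)) (\<phi> (x v))) g E"
      by (rule orders_cong) (simp add: \<phi> c d WE)
    from no_drop[OF j this] show False .
  qed
  have ones: "dot I c z = dot I z z" "dot I z c = dot I z z" if "\<forall>i\<in>I. c i = 1" for c z
  proof -
    have "dot I z c = dot I z (\<lambda>i. 1)" using that by (intro dot_cong) auto
    then show "dot I z c = dot I z z" by (simp add: dot_ones_right)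
    then show "dot I c z = dot I z z" by (simp add: dot_commute)
  qed
  have p1: "\<forall>i\<in>I. p i = 1" if "dot I p p = 1" using odd_ones[OF that p] by blast
  have q1: "\<forall>i\<in>I. q i = 1" if "dot I q q = 1" using odd_ones[OF that q] by blast
  have r1: "\<forall>i\<in>I. r i = 1" if "dot I r r = 1" using odd_ones[OF that r] by blast
  have pq: "\<not> (dot I p p = 0 \<and> dot I q q = 0 \<and> dot I p q = 1)"
    using not_hyperbolic[OF _ _ _ p q st(1)] by blast
  have pr: "\<not> (dot I p p = 0 \<and> dot I r r = 0 \<and> dot I p r = 1)"
    using not_hyperbolic[OF _ _ _ p r less_trans[OF st]] by blast
  have exceptional: "dot I p p = 1 \<and> dot I q q = 0 \<and> dot I r r = 1"
    using pq pr pqr ones[OF p1, of q] ones[OF p1, of r] ones[OF q1, of p] ones[OF q1, of r]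
      ones[OF r1, of p] ones[OF r1, of q]
    by (cases "dot I p p"; cases "dot I q q"; cases "dot I r r"; cases "dot I p q") auto
  have "q i = 0" if "i \<in> I" for i
    using odd_sum_ones[OF _ p q st(1) that] exceptional p1 that by (cases "q i") auto
  then have xq: "dot I (x w) q = 0" for w
    using dot_cong[of I q "\<lambda>i. 0" "x w" "x w"] by (simp add: dot_zero_left dot_commute)
  have "dot I (x w) (\<lambda>i. 1) = 0" if "w \<in> W" for w
  proof -
    have "dot I (x w) (\<lambda>i. 1) = dot I (x w) p" using exceptional p1 by (intro dot_cong) auto
    also have "\<dots> = 0" using xq[of w] p[OF that] q[OF that] st by auto
    finally show ?thesis .
  qed
  moreover have "dot I p p = of_bool (odd (card I))"
    using exceptional p1 dot_cong[of I p "\<lambda>i. 1" p "\<lambda>i. 1"] by (simp add: dot_ones_ones[OF I])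
  ultimately show False using neg exceptional by auto
qed

text \<open>All of \<open>p\<close>, \<open>q\<close>, \<open>r\<close> are even and \<open>p \<bullet> q \<noteq> p \<bullet> r\<close>, so either \<open>p\<close>, \<open>q\<close> or \<open>p\<close>, \<open>r\<close> is a hyperbolic pair.\<close>

lemma remove_three_even_vectors:
  fixes x :: "'v \<Rightarrow> 'i \<Rightarrow> bit"
  assumes I: "finite I" "odd (card I)"
    and ord: "orders (\<lambda>u v. dot I (x u) (x v)) f E" and E: "E \<subseteq> W \<times> W"
    and st: "s1 < s2" "s2 < s3"
    and p: "\<And>w. w \<in> W \<Longrightarrow> dot I (x w) p = of_bool (f w < s1)"
    and q: "\<And>w. w \<in> W \<Longrightarrow> dot I (x w) q = of_bool (f w < s2)"
    and r: "\<And>w. w \<in> W \<Longrightarrow> dot I (x w) r = of_bool (f w < s3)"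
    and pr: "dot I p r = dot I p q + 1"
    and even: "dot I p p = 0" "dot I q q = 0" "dot I r r = 0"
      "\<And>w. w \<in> W \<Longrightarrow> dot I (x w) (\<lambda>i. 1) = 0"
  shows "\<exists>k. card I = k + 2 \<and> decyclable E k"
proof -
  have WE: "u \<in> W" "v \<in> W" if "(u, v) \<in> E" for u v using E that by auto
  have step: ?thesis
    if cd: "dot I c c = 0" "dot I d d = 0" "dot I c d = 1"
      and c: "\<And>w. w \<in> W \<Longrightarrow> dot I (x w) c = of_bool (f w < s)"
      and d: "\<And>w. w \<in> W \<Longrightarrow> dot I (x w) d = of_bool (f w < t)" and st: "s < t"
    for c d s t
  proof -
    obtain J and \<phi> :: "('i \<Rightarrow> bit) \<Rightarrow> 'i \<Rightarrow> bit" where J: "finite J" "card I = card J + 2"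
      and \<phi>: "\<And>x y. dot I x (\<lambda>i. 1) = 0 \<Longrightarrow> dot I y (\<lambda>i. 1) = 0 \<Longrightarrow>
        dot J (\<phi> x) (\<phi> y) = dot I x y + dot I x c * dot I y c
        + (dot I x c + dot I x d) * (dot I y c + dot I y d)"
      using project_hyperbolic_pair_and_ones[OF I cd] by blast
    obtain g where "orders (\<lambda>u v. dot I (x u) (x v) + of_bool (f u < s) * of_bool (f v < s)
      + (of_bool (f u < s) + of_bool (f u < t)) * (of_bool (f v < s) + of_bool (f v < t))) g E"
      using orders_reverse_initial_and_between[OF ord] st less_imp_le by blast
    then have "orders (\<lambda>u v. dot J (\<phi> (x u)) (\<phi> (x v))) g E"
      by (rule orders_cong) (simp add: \<phi> c d WE even)
    from decyclableI[OF J(1) this] J(2) show ?thesis by blast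
  qed
  show ?thesis
  proof (cases "dot I p q = 0")
    case True
    with pr have "dot I p r = 1" by simp
    from step[OF even(1,3) this p r] st show ?thesis by simp
  next
    case False
    then have "dot I p q = 1" by simp
    from step[OF even(1,2) this p q st(1)] show ?thesis by simp
  qed
qed

section \<open>Joins\<close>

lemma kjoin_Cons:
  "((0, u), (0, v)) \<in> parcs (kjoin (G # Gs)) \<longleftrightarrow> (u, v) \<in> parcs G"
  "((0, u), (Suc j, v)) \<in> parcs (kjoin (G # Gs)) \<longleftrightarrow> u \<in> pverts G \<and> (j, v) \<in> pverts (kjoin Gs)"
  "((Suc i, u), (0, v)) \<notin> parcs (kjoin (G # Gs))"
  "((Suc i, u), (Suc j, v)) \<in> parcs (kjoin (G # Gs)) \<longleftrightarrow> ((i, u), (j, v)) \<in> parcs (kjoin Gs)"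
  "(0, u) \<in> pverts (kjoin (G # Gs)) \<longleftrightarrow> u \<in> pverts G"
  by (auto simp: kjoin_def)

lemma oriented_graph_parcs_subset: "oriented_graph G \<Longrightarrow> parcs G \<subseteq> pverts G \<times> pverts G"
proof -
  assume "oriented_graph G"
  then interpret oriented_graph G .
  show ?thesis using in_arcsD1 in_arcsD2 by auto
qed

text \<open>Supports on disjoint coordinates make vectors of different parts orthogonal, so no arc of the join
  between \<open>G\<close> and the rest is reversed, and the orders of the two parts can be concatenated.\<close>

lemma decyclable_kjoin_Cons:
  assumes G: "oriented_graph G" "decyclable (parcs G) m" and Gs: "decyclable (parcs (kjoin Gs)) k"
  shows "decyclable (parcs (kjoin (G # Gs))) (m + k)"
proof -
  interpret oriented_graph G by (rule G(1))
  obtain x1 f1 where 1: "orders (\<lambda>u v. dot {..<m} (x1 u) (x1 v)) f1 (parcs G)"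
    using G(2) unfolding decyclable_def by blast
  obtain x2 f2 where 2: "orders (\<lambda>u v. dot {..<k} (x2 u) (x2 v)) f2 (parcs (kjoin Gs))"
    using Gs unfolding decyclable_def by blast
  define M where "M = Suc (Max (f1 ` pverts G))"
  have M: "f1 v < M" if "v \<in> pverts G" for v
    using that pair_finite_verts by (simp add: M_def less_Suc_eq_le)
  define x :: "nat \<times> 'a \<Rightarrow> nat + nat \<Rightarrow> bit" where
    "x = (\<lambda>(i, v). case i of 0 \<Rightarrow> case_sum (x1 v) (\<lambda>_. 0) | Suc i \<Rightarrow> case_sum (\<lambda>_. 0) (x2 (i, v)))"
  define f where "f = (\<lambda>(i, v). case i of 0 \<Rightarrow> f1 v | Suc i \<Rightarrow> M + f2 (i, v))"
  have dot_Plus: "dot ({..<m} <+> {..<k}) (case_sum a b) (case_sum c d)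
      = dot {..<m} a c + dot {..<k} b d" for a b c d
    by (simp add: dot_def sum.Plus)
  have "orders (\<lambda>u v. dot ({..<m} <+> {..<k}) (x u) (x v)) f (parcs (kjoin (G # Gs)))"
    unfolding orders_def
  proof (intro ballI, clarify)
    fix i u j v assume *: "((i, u), (j, v)) \<in> parcs (kjoin (G # Gs))"
    show "if dot ({..<m} <+> {..<k}) (x (i, u)) (x (j, v)) = 0
      then f (i, u) < f (j, v) else f (j, v) < f (i, u)"
    proof (cases i; cases j)
      assume "i = 0" "j = 0"
      then show ?thesis using * 1
        by (auto simp: kjoin_Cons x_def f_def dot_Plus dot_zero_left orders_def)
    next
      fix j' assume "i = 0" "j = Suc j'"
      then show ?thesis using * M[of u]
        by (auto simp: kjoin_Cons x_def f_def dot_Plus dot_zero_left dot_commute[of _ _ "\<lambda>_. 0"])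
    next
      fix i' assume "i = Suc i'" "j = 0"
      then show ?thesis using * by (simp add: kjoin_Cons)
    next
      fix i' j' assume "i = Suc i'" "j = Suc j'"
      then show ?thesis using * 2
        by (auto simp: kjoin_Cons x_def f_def dot_Plus dot_zero_left orders_def)
    qed
  qed
  from decyclableI[OF _ this] show ?thesis by (simp add: card_Plus)
qed

lemma decyclable_C3:
  "decyclable (parcs (relabel Inl directed_C3 :: (nat + 'b) pair_pre_digraph)) 1"
proof -
  \<comment> \<open>Inverting \<open>{0, 2}\<close> reverses the arc from 2 to 0; 0, 1, 2 is then a topological order.\<close>
  define x :: "nat + 'b \<Rightarrow> nat \<Rightarrow> bit" where "x = (\<lambda>v i. of_bool (v \<noteq> Inl 1))"
  have "orders (\<lambda>u v. dot {..<1} (x u) (x v)) (case_sum id (\<lambda>_. 0))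
      (parcs (relabel Inl directed_C3))"
    by (auto simp: orders_def relabel_def directed_C3_def x_def dot_def)
  then show ?thesis unfolding decyclable_def by (intro exI)
qed

text \<open>An order of the three vertices runs either along the cycle, and then the single arc from the last to
  the first vertex is reversed, or against it, and then exactly the two arcs between consecutive
  vertices are reversed.\<close>

lemma C3_order_pattern:
  assumes "orders \<beta> f {(a, b), (b, c), (c, a)}"
    and sym: "\<And>u v. \<beta> u v = \<beta> v u"
  shows "\<exists>p q r. {p, q, r} = {a, b, c} \<and> f p < f q \<and> f q < f r
    \<and> \<beta> q r = \<beta> p q \<and> \<beta> p r = \<beta> p q + 1"
proof -
  have rot: ?thesis if "orders \<beta> f {(a', b'), (b', c'), (c', a')}" "{a', b', c'} = {a, b, c}"
    "f a' < f b'" "f a' < f c'" for a' b' c'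
  proof (cases "f b' < f c'")
    case True
    then have "\<beta> a' b' = 0" "\<beta> b' c' = 0" "\<beta> a' c' = 1"
      using that sym[of a' c'] by (auto simp: orders_def split: if_splits)
    with True that show ?thesis by (intro exI[of _ a'] exI[of _ b'] exI[of _ c']) auto
  next
    case False
    then have "\<beta> a' b' = 0" "\<beta> c' b' = 1" "\<beta> a' c' = 1" "f c' < f b'"
      using that sym[of a' c'] sym[of b' c'] by (auto simp: orders_def split: if_splits)
    with that show ?thesis by (intro exI[of _ a'] exI[of _ c'] exI[of _ b']) auto
  qed
  have "f a < f b \<and> f a < f c \<or> f b < f c \<and> f b < f a \<or> f c < f a \<and> f c < f b"
    using assms(1) by (auto simp: orders_def split: if_splits)
  then show ?thesis
    using rot[of a b c] rot[of b c a] rot[of c a b] assms(1) by (auto simp: insert_commute)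
qed

text \<open>Every arc from a vertex \<open>c\<close> of the 3-cycle to a vertex of the rest is present, and it is reversed
  iff its head comes before \<open>c\<close>; so the product with \<open>x c\<close> is determined by the order.\<close>

lemma kjoin_C3_profile:
  fixes g :: "nat \<Rightarrow> 'a"
  assumes ord: "orders (\<lambda>u v. dot I (x u) (x v)) f (parcs (kjoin (relabel g directed_C3 # Gs)))"
  obtains p q r where "{p, q, r} = (\<lambda>i. (0, g i)) ` {0, 1, 2}" "f p < f q" "f q < f r"
    "dot I (x q) (x r) = dot I (x p) (x q)" "dot I (x p) (x r) = dot I (x p) (x q) + 1"
    "\<And>i w c. (i, w) \<in> pverts (kjoin Gs) \<Longrightarrow> c \<in> {p, q, r} \<Longrightarrow>
       dot I (x (Suc i, w)) (x c) = of_bool (f (Suc i, w) < f c)"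
proof -
  let ?E = "parcs (kjoin (relabel g directed_C3 # Gs))"
  let ?a = "\<lambda>i. (0, g i)"
  have "{(?a 0, ?a 1), (?a 1, ?a 2), (?a 2, ?a 0)} \<subseteq> ?E"
    by (simp add: kjoin_Cons relabel_def directed_C3_def)
  with ord have "orders (\<lambda>u v. dot I (x u) (x v)) f {(?a 0, ?a 1), (?a 1, ?a 2), (?a 2, ?a 0)}"
    unfolding orders_def by blast
  from C3_order_pattern[OF this dot_commute] obtain p q r where
    pqr: "{p, q, r} = {?a 0, ?a 1, ?a 2}" "f p < f q" "f q < f r"
    "dot I (x q) (x r) = dot I (x p) (x q)" "dot I (x p) (x r) = dot I (x p) (x q) + 1"
    by blast
  have "dot I (x (Suc i, w)) (x c) = of_bool (f (Suc i, w) < f c)"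
    if "(i, w) \<in> pverts (kjoin Gs)" "c \<in> {p, q, r}" for i w c
  proof -
    have "(c, (Suc i, w)) \<in> ?E"
      using that unfolding pqr by (auto simp: kjoin_Cons relabel_def directed_C3_def)
    with ord have "if dot I (x c) (x (Suc i, w)) = 0 then f c < f (Suc i, w) else f (Suc i, w) < f c"
      by (auto simp: orders_def)
    then show ?thesis by (auto simp: dot_commute[of I "x c"] split: if_splits)
  qed
  with pqr that show thesis by simp
qed

lemma orders_kjoin_tail:
  assumes "orders (\<lambda>u v. dot I (x u) (x v)) f (parcs (kjoin (G # Gs)))"
  shows "orders (\<lambda>u v. dot I (x (map_prod Suc id u)) (x (map_prod Suc id v))) (\<lambda>u. f (map_prod Suc id u))
    (parcs (kjoin Gs))"
  unfolding orders_def
proof (intro ballI)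
  fix e assume "e \<in> parcs (kjoin Gs)"
  then have "map_prod (map_prod Suc id) (map_prod Suc id) e \<in> parcs (kjoin (G # Gs))"
    by (auto simp: kjoin_Cons(4) map_prod_def split: prod.splits)
  then show "case e of (u, v) \<Rightarrow>
      if dot I (x (map_prod Suc id u)) (x (map_prod Suc id v)) = 0
      then f (map_prod Suc id u) < f (map_prod Suc id v)
      else f (map_prod Suc id v) < f (map_prod Suc id u)"
    using assms by (cases e) (auto simp: orders_def)
qed

text \<open>The product of a vector with the all-ones vector is the parity of its weight.\<close>

definition evenly_decyclable :: "'v pair_pre_digraph \<Rightarrow> nat \<Rightarrow> bool" where
  "evenly_decyclable G k \<longleftrightarrow> (\<exists>x f. orders (\<lambda>u v. dot {..<k} (x u) (x v)) f (parcs G)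
     \<and> (\<forall>v\<in>pverts G. dot {..<k} (x v) (\<lambda>i. 1) = 0))"

lemma kjoin_C3_remove:
  assumes Gs: "oriented_graph (kjoin Gs)"
    and "decyclable (parcs (kjoin (relabel g directed_C3 # Gs))) k"
  shows "(\<exists>k'. k = Suc k' \<and> decyclable (parcs (kjoin Gs)) k')
    \<or> odd k \<and> evenly_decyclable (kjoin Gs) k"
proof -
  obtain x f where ord: "orders (\<lambda>u v. dot {..<k} (x u) (x v)) f
      (parcs (kjoin (relabel g directed_C3 # Gs)))"
    using assms(2) unfolding decyclable_def by blast
  obtain p q r where pqr: "f p < f q" "f q < f r"
    "dot {..<k} (x q) (x r) = dot {..<k} (x p) (x q)"
    "dot {..<k} (x p) (x r) = dot {..<k} (x p) (x q) + 1"
    and prof: "\<And>i w c. (i, w) \<in> pverts (kjoin Gs) \<Longrightarrow> c \<in> {p, q, r} \<Longrightarrow>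
       dot {..<k} (x (Suc i, w)) (x c) = of_bool (f (Suc i, w) < f c)"
    using kjoin_C3_profile[OF ord] by metis
  let ?h = "map_prod Suc id"
  have prof': "dot {..<k} (x (?h w)) (x c) = of_bool (f (?h w) < f c)"
    if "w \<in> pverts (kjoin Gs)" "c \<in> {p, q, r}" for w c
    using prof[of "fst w" "snd w" c] that by (cases w) simp
  note tail = orders_kjoin_tail[OF ord]
  show ?thesis
    using remove_three_vectors[OF _ tail oriented_graph_parcs_subset[OF Gs] pqr(1,2)
        prof' prof' prof' pqr(3,4)] tail
    unfolding evenly_decyclable_def by auto
qed

lemma kjoin_C3_remove_evenly:
  assumes Gs: "oriented_graph (kjoin Gs)" and k: "odd k"
    and "evenly_decyclable (kjoin (relabel g directed_C3 # Gs)) k"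
  shows "\<exists>k'. k = k' + 2 \<and> decyclable (parcs (kjoin Gs)) k'"
proof -
  let ?G = "kjoin (relabel g directed_C3 # Gs)"
  obtain x f where ord: "orders (\<lambda>u v. dot {..<k} (x u) (x v)) f (parcs ?G)"
    and even: "\<And>v. v \<in> pverts ?G \<Longrightarrow> dot {..<k} (x v) (\<lambda>i. 1) = 0"
    using assms(3) unfolding evenly_decyclable_def by blast
  obtain p q r where set: "{p, q, r} = (\<lambda>i. (0, g i)) ` {0, 1, 2}"
    and pqr: "f p < f q" "f q < f r"
    "dot {..<k} (x q) (x r) = dot {..<k} (x p) (x q)"
    "dot {..<k} (x p) (x r) = dot {..<k} (x p) (x q) + 1"
    and prof: "\<And>i w c. (i, w) \<in> pverts (kjoin Gs) \<Longrightarrow> c \<in> {p, q, r} \<Longrightarrow>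
       dot {..<k} (x (Suc i, w)) (x c) = of_bool (f (Suc i, w) < f c)"
    using kjoin_C3_profile[OF ord] by metis
  let ?h = "map_prod Suc id"
  have prof': "dot {..<k} (x (?h w)) (x c) = of_bool (f (?h w) < f c)"
    if "w \<in> pverts (kjoin Gs)" "c \<in> {p, q, r}" for w c
    using prof[of "fst w" "snd w" c] that by (cases w) simp
  have "(\<lambda>i. (0, g i)) ` {0, 1, 2} \<subseteq> pverts ?G"
    by (auto simp: kjoin_Cons relabel_def directed_C3_def)
  then have "{p, q, r} \<subseteq> pverts ?G" unfolding set .
  then have norm: "dot {..<k} (x c) (x c) = 0" if "c \<in> {p, q, r}" for c
    using even[of c] that by (auto simp: dot_ones_right)
  have even': "dot {..<k} (x (?h w)) (\<lambda>i. 1) = 0" if "w \<in> pverts (kjoin Gs)" for w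
    using even[of "?h w"] that by (cases w) (auto simp: kjoin_def)
  show ?thesis
    using remove_three_even_vectors[OF _ _ orders_kjoin_tail[OF ord]
        oriented_graph_parcs_subset[OF Gs] pqr(1,2) prof' prof' prof' pqr(4)
        norm norm norm even'] k
    by simp
qed

theorem theorem1p9:
  fixes D :: "'a pair_pre_digraph"
  assumes "oriented_graph D"
  shows "inversion_number (kjoin [relabel Inl directed_C3, relabel Inl directed_C3, relabel Inr D])
         = inversion_number (relabel Inl directed_C3 \<Rrightarrow> relabel Inr D) + 1"
proof -
  let ?C = "relabel Inl directed_C3 :: (nat + 'a) pair_pre_digraph"
  let ?D = "relabel Inr D :: (nat + 'a) pair_pre_digraph"
  have C: "oriented_graph ?C"
    by (intro oriented_graph_relabel oriented_graph_directed_C3) simp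
  have D: "oriented_graph ?D"
    by (intro oriented_graph_relabel assms) simp
  have join: "oriented_graph (kjoin [?C, ?C, ?D])" "oriented_graph (kjoin [?C, ?D])"
    "oriented_graph (kjoin [?D])"
    using C D by (auto intro!: oriented_graph_kjoin)
  let ?n = "inversion_number (kjoin [?C, ?C, ?D])"
  let ?m = "inversion_number (kjoin [?C, ?D])"
  have "decyclable (parcs (kjoin [?C, ?C, ?D])) (1 + ?m)"
    by (intro decyclable_kjoin_Cons C decyclable_C3 decyclable_inversion_number join)
  then have "?n \<le> ?m + 1"
    using inversion_number_le[OF join(1)] by simp
  moreover have "?m + 1 \<le> ?n"
    using kjoin_C3_remove[OF join(2) decyclable_inversion_number[OF join(1)]]
  proof (elim disjE conjE exE)
    fix k assume "?n = Suc k" "decyclable (parcs (kjoin [?C, ?D])) k"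
    then show ?thesis using inversion_number_le[OF join(2)] by fastforce
  next
    assume "odd ?n" "evenly_decyclable (kjoin [?C, ?D]) ?n"
    from kjoin_C3_remove_evenly[OF join(3) this] obtain k where
      k: "?n = k + 2" "decyclable (parcs (kjoin [?D])) k" by blast
    have "decyclable (parcs (kjoin [?C, ?D])) (1 + k)"
      by (intro decyclable_kjoin_Cons C decyclable_C3 k)
    then show ?thesis using inversion_number_le[OF join(2)] k by fastforce
  qed
  ultimately show ?thesis by (simp add: dijoin_def)
qed

end
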